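(* For every online (possibly randomized) algorithm for the maximum budgeted allocation problem, there exists an instance on which the algorithm's expected revenue is at most $0.612$ times the optimal value of the linear program $$\max \sum_{a\in A,i\in Q} b_{ai}x_{ai}\quad\text{s.t.}\quad \sum_{i\in Q} b_{ai}x_{ai}\le B_a\ \ \forall a\in A;\qquad \sum_{a\in A}x_{ai}\le 1\ \ \forall i\in Q;\qquad x_{ai}\ge 0 .$$ In other words, no online algorithm achieves, in expectation, more than a $0.612$-fraction of this LP value on all instances.
   Context: Maximum budgeted allocation (MBA): there is a set $Q$ of $m$ indivisible items and a set $A$ of $n$ agents. Agent $a$ bids $b_{ai}\ge 0$ for item $i$ and has budget $B_a$, where one may assume $b_{ai}\le B_a$. An allocation partitions $Q$ into disjoint sets $\Gamma(a)$, $a\in A$, and has revenue $\sum_{a\in A}\min\{B_a,\sum_{i\in\Gamma(a)}b_{ai}\}$. In the online version, items arrive one at a time. When an item arrives, its bids are revealed and the item must be irrevocably assigned to an agent (or discarded). *)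

theory Defs
  imports "HOL-Probability.Probability"
begin

text \<open>
  Agents are 0..<n. Budgets B :: nat => real. Items arrive in the order of a list
  bs; the k-th item is represented by its bid vector (bs ! k) :: nat => real,
  i.e. (bs ! k) a is the bid of agent a for item k.
\<close>

type_synonym bidvec = "nat \<Rightarrow> real"
type_synonym history = "(bidvec \<times> nat option) list"

text \<open>A (possibly randomized) online algorithm: given the number of agents, the budgets,
  the history (bid vectors of the items seen so far together with the decisions made),
  and the bid vector of the newly arrived item, it returns a probability distribution
  over decisions: Some a = assign to agent a, None = discard.  Choices outside the agent
  set are treated as discarding the item.\<close>
type_synonym online_alg = "nat \<Rightarrow> (nat \<Rightarrow> real) \<Rightarrow> history \<Rightarrow> bidvec \<Rightarrow> nat option pmf"

definition valid_instance :: "nat \<Rightarrow> (nat \<Rightarrow> real) \<Rightarrow> bidvec list \<Rightarrow> bool" where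
  "valid_instance n B bs \<longleftrightarrow>
     (\<forall>x\<in>set bs. \<forall>a<n. 0 \<le> x a \<and> x a \<le> B a)"

fun run_alg :: "online_alg \<Rightarrow> nat \<Rightarrow> (nat \<Rightarrow> real) \<Rightarrow> history \<Rightarrow> bidvec list \<Rightarrow> history pmf" where
  "run_alg alg n B h [] = return_pmf h"
| "run_alg alg n B h (x # xs) =
     bind_pmf (alg n B h x) (\<lambda>c. run_alg alg n B (h @ [(x, c)]) xs)"

definition revenue :: "nat \<Rightarrow> (nat \<Rightarrow> real) \<Rightarrow> history \<Rightarrow> real" where
  "revenue n B h = (\<Sum>a<n. min (B a) (\<Sum>(x, c)\<leftarrow>h. if c = Some a then x a else 0))"

definition expected_revenue :: "online_alg \<Rightarrow> nat \<Rightarrow> (nat \<Rightarrow> real) \<Rightarrow> bidvec list \<Rightarrow> real" where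
  "expected_revenue alg n B bs =
     measure_pmf.expectation (run_alg alg n B [] bs) (revenue n B)"

definition lp_feasible :: "nat \<Rightarrow> (nat \<Rightarrow> real) \<Rightarrow> bidvec list \<Rightarrow> (nat \<Rightarrow> nat \<Rightarrow> real) \<Rightarrow> bool" where
  "lp_feasible n B bs x \<longleftrightarrow>
     (\<forall>a<n. (\<Sum>k<length bs. (bs ! k) a * x a k) \<le> B a) \<and>
     (\<forall>k<length bs. (\<Sum>a<n. x a k) \<le> 1) \<and>
     (\<forall>a<n. \<forall>k<length bs. 0 \<le> x a k)"

definition lp_value :: "nat \<Rightarrow> (nat \<Rightarrow> real) \<Rightarrow> bidvec list \<Rightarrow> real" where
  "lp_value n B bs =
     Sup {\<Sum>a<n. \<Sum>k<length bs. (bs ! k) a * x a k | x. lp_feasible n B bs x}"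

end

theory Submission
  imports Defs
begin

text \<open>
  All budgets are 3 and every item is worth 2 to each agent of a shrinking set \<open>R\<close> and 0 to
  the others, so an agent gets full value 2 from its first item but only 1 from its second.
  Each stage presents three identical items and then drops two agents from \<open>R\<close>. Fractionally,
  the three items of a stage exhaust the budgets of the two agents dropped after it, so the LP
  value is the total budget. The online algorithm does not know who is dropped: the adversary
  removes the agents with the most expected unused capacity, measured by \<open>weight\<close>. With
  \<open>8 * M\<close> agents, the revenue collected so far plus the average weight over \<open>R\<close> grows by at most
  \<open>gain M k\<close> per item while \<open>R\<close> has \<open>2 * k\<close> agents. Summing up bounds the ratio by
  \<open>23/24 - ln 2 / 2 + O(1/M)\<close>, and \<open>23/24 - ln 2 / 2 < 0.6118\<close>.
\<close>

section \<open>Expectations of bounded functions, and finite averages\<close>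

lemma integrable_pmf_bounded:
  fixes f :: "'a \<Rightarrow> real"
  assumes "\<And>x. \<bar>f x\<bar> \<le> C"
  shows "integrable (measure_pmf p) f"
  by (rule measure_pmf.integrable_const_bound[where B = C]) (use assms in auto)

lemma expectation_bind_pmf_bounded:
  fixes f :: "'b \<Rightarrow> real"
  assumes "\<And>x. \<bar>f x\<bar> \<le> C"
  shows "measure_pmf.expectation (bind_pmf p q) f =
    measure_pmf.expectation p (\<lambda>x. measure_pmf.expectation (q x) f)"
  unfolding measure_pmf_bind
  by (rule integral_bind[where K = "count_space UNIV" and B = C and B' = 1])
    (use assms in \<open>auto simp: measure_pmf.finite_measure_axioms measure_pmf.emeasure_space_1[simplified] measure_pmf_in_subprob_space\<close>)

text \<open>Some element has at least the average value; dropping it cannot raise the average of the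
  rest.\<close>

lemma exists_remove_average_le:
  fixes f :: "'a \<Rightarrow> real"
  assumes "finite R" "card R \<ge> 2"
  shows "\<exists>a\<in>R. sum f (R - {a}) / real (card (R - {a})) \<le> sum f R / real (card R)"
proof -
  have ne: "R \<noteq> {}" using assms by auto
  let ?r = "real (card R)"
  have pos: "?r > 0" using assms by linarith
  have "\<exists>a\<in>R. f a \<ge> sum f R / ?r"
  proof (rule ccontr)
    assume "\<not> ?thesis"
    then have "sum f R < (\<Sum>a\<in>R. sum f R / ?r)"
      using assms ne by (intro sum_strict_mono) auto
    then show False using assms ne by simp
  qed
  then obtain a where a: "a \<in> R" "f a \<ge> sum f R / ?r" by blast
  have s: "sum f (R - {a}) = sum f R - f a"
    using a assms by (simp add: sum_diff1)
  have c: "real (card (R - {a})) = ?r - 1"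
    using a assms by (simp add: of_nat_diff)
  have "(?r - 1) * (sum f R / ?r) = sum f R - sum f R / ?r"
    using pos by (simp add: left_diff_distrib diff_divide_distrib)
  with a have "sum f R - f a \<le> (?r - 1) * (sum f R / ?r)"
    by linarith
  then have "sum f (R - {a}) / real (card (R - {a})) \<le> sum f R / ?r"
    unfolding s c using assms by (simp add: pos_divide_le_eq mult.commute)
  then show ?thesis using a by blast
qed

section \<open>The potential and its growth per item\<close>

text \<open>Zero bids are not counted, so an item handed to an agent outside the current set has the
  same effect as a discarded one.\<close>

definition level :: "history \<Rightarrow> nat \<Rightarrow> nat" where
  "level h a = length (filter (\<lambda>(x, c). c = Some a \<and> x a \<noteq> 0) h)"

definition bid :: "nat set \<Rightarrow> bidvec" where
  "bid R = (\<lambda>a. if a \<in> R then 2 else 0)"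

definition pay :: "nat \<Rightarrow> real" where
  "pay l = min 3 (2 * real l)"

text \<open>
  The weights 8 and 2 make the three cases of \<open>gain\<close> meet at \<open>k = M\<close> and \<open>k = 2 * M\<close>. These
  fractions 1/4 and 1/2 of the initial size of \<open>R\<close> approximate the optimal thresholds
  \<open>exp (-4/3)\<close> and \<open>exp (-2/3)\<close>.
\<close>
definition weight :: "nat \<Rightarrow> nat \<Rightarrow> real" where
  "weight M l = (if l = 0 then 8 * real M else if l = 1 then 2 * real M else 0)"

text \<open>Dropped agents keep their revenue, hence the first sum over all agents; only those in
  \<open>R\<close> can still earn. At \<open>R = {}\<close> the second summand is 0, so the
  potential ends as plain revenue.\<close>

definition potential :: "nat \<Rightarrow> nat \<Rightarrow> nat set \<Rightarrow> history \<Rightarrow> real" where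
  "potential M n R h =
     (\<Sum>a<n. pay (level h a)) + (\<Sum>a\<in>R. weight M (level h a)) / real (card R)"

text \<open>The maximum, over the level of the receiving agent, of the change in potential when
  \<open>R\<close> has \<open>2 * k\<close> agents: at level 0, 1 or higher the revenue rises by 2,
  1 or 0, while the average weight falls by \<open>6 * M / (2 * k)\<close>,
  \<open>2 * M / (2 * k)\<close> or 0.\<close>

definition gain :: "nat \<Rightarrow> nat \<Rightarrow> real" where
  "gain M k = (if k \<le> M then 0 else if k \<le> 2 * M then 1 - real M / real k
     else 2 - 3 * real M / real k)"

lemma gain_ge:
  assumes "k \<ge> 1"
  shows "0 \<le> gain M k" "1 - real M / real k \<le> gain M k" "2 - 3 * real M / real k \<le> gain M k"
proof -
  have "real k > 0" using assms by simp
  moreover have "real k \<le> real M \<longleftrightarrow> k \<le> M" "real k \<le> 2 * real M \<longleftrightarrow> k \<le> 2 * M"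
    by linarith+
  ultimately show "0 \<le> gain M k" "1 - real M / real k \<le> gain M k"
    "2 - 3 * real M / real k \<le> gain M k"
    unfolding gain_def by (auto simp: field_simps)
qed

lemma level_snoc:
  "level (h @ [(bid R, c)]) a = level h a + (if c = Some a \<and> a \<in> R then 1 else 0)"
  by (auto simp: level_def bid_def)

lemma pay_bounds: "0 \<le> pay l" "pay l \<le> 3"
  by (auto simp: pay_def)

lemma weight_bounds: "0 \<le> weight M l" "weight M l \<le> 8 * real M"
  by (auto simp: weight_def)

lemma potential_bounded: "\<bar>potential M n R h\<bar> \<le> 3 * real n + 8 * real M"
proof -
  have a: "0 \<le> (\<Sum>a<n. pay (level h a))" "(\<Sum>a<n. pay (level h a)) \<le> 3 * real n"
    using sum_bounded_above[of "{..<n}" "\<lambda>a. pay (level h a)" 3]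
    by (auto intro: sum_nonneg simp: pay_bounds mult.commute)
  have b: "0 \<le> (\<Sum>a\<in>R. weight M (level h a))"
    "(\<Sum>a\<in>R. weight M (level h a)) \<le> real (card R) * (8 * real M)"
    using sum_bounded_above[of R "\<lambda>a. weight M (level h a)" "8 * real M"]
    by (auto intro: sum_nonneg simp: weight_bounds)
  have "(\<Sum>a\<in>R. weight M (level h a)) / real (card R) \<le> 8 * real M"
    using b by (cases "card R = 0") (auto simp: field_simps)
  moreover have "0 \<le> (\<Sum>a\<in>R. weight M (level h a)) / real (card R)"
    using b by simp
  ultimately show ?thesis using a unfolding potential_def by linarith
qed

lemma integrable_potential: "integrable (measure_pmf p) (\<lambda>c. potential M n R (g c))"
  by (rule integrable_pmf_bounded[OF potential_bounded])

lemma potential_step: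
  assumes R: "R \<subseteq> {..<n}" "card R = 2 * k" "k \<ge> 1"
  shows "potential M n R (h @ [(bid R, c)]) \<le> potential M n R h + gain M k"
proof (cases "\<exists>a\<in>R. c = Some a")
  case False
  then have "level (h @ [(bid R, c)]) = level h"
    by (auto simp: level_snoc fun_eq_iff)
  then show ?thesis using gain_ge(1)[OF R(3)] by (simp add: potential_def)
next
  case True
  then obtain b where b: "b \<in> R" "c = Some b" by blast
  let ?l = "level h b"
  have fin: "finite R" using R(1) finite_subset by blast
  have lev: "level (h @ [(bid R, c)]) a = (if a = b then Suc ?l else level h a)" for a
    using b by (auto simp: level_snoc)
  \<comment> \<open>Only one agent changes level, so each sum changes in a single term. The general
    \<open>A\<close> and \<open>g\<close> serve both \<open>pay\<close> over all agents and
    \<open>weight\<close> over \<open>R\<close>.\<close>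
  have upd: "(\<Sum>a\<in>A. g (level (h @ [(bid R, c)]) a)) =
      (\<Sum>a\<in>A. g (level h a)) + (g (Suc ?l) - g ?l)"
    if "finite A" "b \<in> A" for A and g :: "nat \<Rightarrow> real"
  proof -
    have "(\<Sum>a\<in>A - {b}. g (level (h @ [(bid R, c)]) a)) = (\<Sum>a\<in>A - {b}. g (level h a))"
      by (rule sum.cong) (auto simp: lev)
    moreover have "g (level (h @ [(bid R, c)]) b) = g (Suc ?l)"
      by (simp add: lev)
    ultimately show ?thesis
      using sum.remove[OF that, of "\<lambda>a. g (level h a)"]
        sum.remove[OF that, of "\<lambda>a. g (level (h @ [(bid R, c)]) a)"]
      by linarith
  qed
  have "pay (Suc ?l) - pay ?l + (weight M (Suc ?l) - weight M ?l) / (2 * real k) \<le> gain M k"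
  proof -
    consider "?l = 0" | "?l = 1" | "?l \<ge> 2" by linarith
    then show ?thesis
    proof cases
      case 1
      then show ?thesis using gain_ge(3)[OF R(3), of M]
        by (simp add: pay_def weight_def)
    next
      case 2
      then show ?thesis using gain_ge(2)[OF R(3), of M]
        by (simp add: pay_def weight_def)
    next
      case 3
      then show ?thesis using gain_ge(1)[OF R(3), of M]
        by (simp add: pay_def weight_def)
    qed
  qed
  moreover have "b < n" using b R by auto
  ultimately show ?thesis
    unfolding potential_def upd[OF fin b(1), of "weight M"]
    using upd[of "{..<n}" pay] R(2) by (simp add: add_divide_distrib)
qed

section \<open>Expected potential under the algorithm\<close>

text \<open>Acts on the law of the history, not on a single history: the instance is fixed in
  advance, from knowledge of the algorithm but not of its random choices.\<close>

definition step :: "online_alg \<Rightarrow> nat \<Rightarrow> (nat \<Rightarrow> real) \<Rightarrow> bidvec \<Rightarrow> history pmf \<Rightarrow> history pmf" where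
  "step alg n B x P = bind_pmf P (\<lambda>h. map_pmf (\<lambda>c. h @ [(x, c)]) (alg n B h x))"

lemma bind_run_alg_Cons:
  "bind_pmf P (\<lambda>h. run_alg alg n B h (x # xs)) =
   bind_pmf (step alg n B x P) (\<lambda>h. run_alg alg n B h xs)"
  by (simp add: step_def bind_assoc_pmf bind_map_pmf)

text \<open>\<open>potential_step\<close> holds for every decision, hence on average over any
  distribution of decisions; boundedness of the potential gives integrability.\<close>

lemma expectation_potential_step:
  assumes "R \<subseteq> {..<n}" "card R = 2 * k" "k \<ge> 1"
  shows "measure_pmf.expectation (step alg n B (bid R) P) (potential M n R) \<le>
         measure_pmf.expectation P (potential M n R) + gain M k"
proof -
  have "measure_pmf.expectation (step alg n B (bid R) P) (potential M n R) =
      measure_pmf.expectation P (\<lambda>h. measure_pmf.expectation (alg n B h (bid R))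
        (\<lambda>c. potential M n R (h @ [(bid R, c)])))"
    unfolding step_def by (subst expectation_bind_pmf_bounded[OF potential_bounded]) simp
  also have "\<dots> \<le> measure_pmf.expectation P (\<lambda>h. potential M n R h + gain M k)"
  proof (rule integral_mono)
    have "\<bar>measure_pmf.expectation (alg n B h (bid R)) (\<lambda>c. potential M n R (h @ [(bid R, c)]))\<bar>
        \<le> 3 * real n + 8 * real M" for h
    proof -
      have "\<bar>measure_pmf.expectation (alg n B h (bid R)) (\<lambda>c. potential M n R (h @ [(bid R, c)]))\<bar>
          \<le> measure_pmf.expectation (alg n B h (bid R)) (\<lambda>c. 3 * real n + 8 * real M)"
        by (rule order_trans[OF integral_abs_bound], rule integral_mono)
          (auto intro!: integrable_abs integrable_potential potential_bounded)
      then show ?thesis by simp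
    qed
    then show "integrable P (\<lambda>h. measure_pmf.expectation (alg n B h (bid R))
        (\<lambda>c. potential M n R (h @ [(bid R, c)])))"
      by (rule integrable_pmf_bounded)
  next
    show "integrable P (\<lambda>h. potential M n R h + gain M k)"
      by (simp add: integrable_potential)
  next
    fix h
    have "measure_pmf.expectation (alg n B h (bid R)) (\<lambda>c. potential M n R (h @ [(bid R, c)]))
        \<le> measure_pmf.expectation (alg n B h (bid R)) (\<lambda>c. potential M n R h + gain M k)"
      by (rule integral_mono)
        (auto intro!: integrable_potential potential_step assms)
    then show "measure_pmf.expectation (alg n B h (bid R)) (\<lambda>c. potential M n R (h @ [(bid R, c)]))
        \<le> potential M n R h + gain M k" by simp
  qed
  also have "\<dots> = measure_pmf.expectation P (potential M n R) + gain M k"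
    by (simp add: integrable_potential)
  finally show ?thesis .
qed

text \<open>By linearity, \<open>R\<close> enters only through the average of the expected weights,
  so an agent of at least average expected weight can be removed.\<close>

lemma expectation_potential_remove:
  assumes "finite R" "card R \<ge> 2"
  shows "\<exists>a\<in>R. measure_pmf.expectation P (potential M n (R - {a})) \<le>
           measure_pmf.expectation P (potential M n R)"
proof -
  let ?f = "\<lambda>a. measure_pmf.expectation P (\<lambda>h. weight M (level h a))"
  have iw: "integrable P (\<lambda>h. weight M (level h a))" for a
    by (rule integrable_pmf_bounded[where C = "8 * real M"]) (use weight_bounds in auto)
  have ip: "integrable P (\<lambda>h. pay (level h a))" for a
    by (rule integrable_pmf_bounded[where C = 3]) (use pay_bounds in auto)
  have eq: "measure_pmf.expectation P (potential M n S) =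
      measure_pmf.expectation P (\<lambda>h. \<Sum>a<n. pay (level h a)) + sum ?f S / real (card S)" for S
    unfolding potential_def using iw ip by simp
  show ?thesis
    unfolding eq using exists_remove_average_le[OF assms, of ?f] by auto
qed

section \<open>The hard instance and its fractional allocation\<close>

text \<open>Induction over the stages; the arbitrary law \<open>P\<close> lets the hypothesis start
  from the law reached after one stage. Since \<open>x\<close> vanishes off \<open>R\<close>, later
  stages put no load on agents dropped earlier.\<close>

lemma adversary:
  fixes P :: "history pmf"
  assumes "R \<subseteq> {..<n}" "card R = 2 * k"
  shows "\<exists>bs x. set bs \<subseteq> range bid \<and>
     (\<forall>a\<in>R. (\<Sum>j<length bs. (bs ! j) a * x a j) = 3) \<and>
     (\<forall>j. (\<Sum>a\<in>R. x a j) \<le> 1) \<and> (\<forall>a j. 0 \<le> x a j) \<and> (\<forall>a j. a \<notin> R \<longrightarrow> x a j = 0) \<and>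
     measure_pmf.expectation (bind_pmf P (\<lambda>h. run_alg alg n B h bs)) (potential M n {}) \<le>
     measure_pmf.expectation P (potential M n R) + 3 * (\<Sum>j=1..k. gain M j)"
  using assms
proof (induction k arbitrary: R P)
  case 0
  then have "R = {}" using finite_subset[OF "0.prems"(1)] by auto
  then show ?case
    by (intro exI[of _ "[]"] exI[of _ "\<lambda>_ _. 0"]) (simp add: bind_return_pmf')
next
  case (Suc k)
  have fin: "finite R" using Suc.prems(1) finite_subset by blast
  define S where "S = step alg n B (bid R)"
  define Q where "Q = S (S (S P))"
  have st: "measure_pmf.expectation (S P') (potential M n R) \<le>
      measure_pmf.expectation P' (potential M n R) + gain M (Suc k)" for P'
    unfolding S_def by (rule expectation_potential_step) (use Suc.prems in auto)
  have Q: "measure_pmf.expectation Q (potential M n R) \<le>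
      measure_pmf.expectation P (potential M n R) + 3 * gain M (Suc k)"
    unfolding Q_def using st[of P] st[of "S P"] st[of "S (S P)"] by linarith
  obtain a where a: "a \<in> R" "measure_pmf.expectation Q (potential M n (R - {a})) \<le>
      measure_pmf.expectation Q (potential M n R)"
    using expectation_potential_remove[OF fin, of Q M n] Suc.prems by auto
  obtain b where b: "b \<in> R - {a}" "measure_pmf.expectation Q (potential M n (R - {a} - {b})) \<le>
      measure_pmf.expectation Q (potential M n (R - {a}))"
  proof (cases "k = 0")
    \<comment> \<open>The last agent leaves, so averaging does not apply; the second summand of the
      potential becomes 0, and it was nonnegative before.\<close>
    case True
    then have "card (R - {a}) = 1" using a Suc.prems fin by simp
    then obtain b where b: "R - {a} = {b}" by (auto simp: card_1_singleton_iff)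
    have "measure_pmf.expectation Q (potential M n (R - {a} - {b})) \<le>
      measure_pmf.expectation Q (potential M n (R - {a}))"
      by (rule integral_mono[OF integrable_potential integrable_potential])
        (simp add: b potential_def weight_bounds)
    with b that show ?thesis by blast
  next
    case False
    then show ?thesis
      using expectation_potential_remove[of "R - {a}" Q M n] a Suc.prems fin that by auto
  qed
  define T where "T = R - {a} - {b}"
  have T: "T \<subseteq> {..<n}" "card T = 2 * k"
    using a b Suc.prems fin by (auto simp: T_def)
  obtain bs x where IH: "set bs \<subseteq> range bid"
    "\<And>a. a \<in> T \<Longrightarrow> (\<Sum>j<length bs. (bs ! j) a * x a j) = 3"
    "\<And>j. (\<Sum>a\<in>T. x a j) \<le> 1" "\<And>a j. 0 \<le> x a j" "\<And>a j. a \<notin> T \<Longrightarrow> x a j = 0"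
    "measure_pmf.expectation (bind_pmf Q (\<lambda>h. run_alg alg n B h bs)) (potential M n {}) \<le>
     measure_pmf.expectation Q (potential M n T) + 3 * (\<Sum>j=1..k. gain M j)"
    using Suc.IH[OF T, of Q] by blast
  define bs' where "bs' = bid R # bid R # bid R # bs"
  \<comment> \<open>Halving each of the three new items between \<open>a\<close> and
    \<open>b\<close> loads each of them with \<open>3 * 2 * (1/2) = 3\<close>, its whole budget. The
    later items follow \<open>x\<close>, shifted by three places.\<close>
  define y where "y c j = (if j < 3 then if c \<in> {a, b} then 1/2 else 0 else x c (j - 3))" for c j
  have R: "R = insert a (insert b T)" "a \<noteq> b" "a \<notin> T" "b \<notin> T" "finite T"
    using a b fin by (auto simp: T_def)
  have load: "(\<Sum>j<length bs'. (bs' ! j) c * y c j) =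
      (if c \<in> {a, b} then 3 else 0) + (\<Sum>j<length bs. (bs ! j) c * x c j)" for c
    unfolding bs'_def using R
    by (simp add: sum.lessThan_Suc_shift y_def bid_def del: sum.lessThan_Suc)
  have "\<forall>c\<in>R. (\<Sum>j<length bs'. (bs' ! j) c * y c j) = 3"
    using IH(2,5) R by (auto simp: load)
  moreover have "\<forall>j. (\<Sum>c\<in>R. y c j) \<le> 1"
  proof
    fix j
    have "(\<Sum>c\<in>T. y c j) = (if j < 3 then 0 else \<Sum>c\<in>T. x c (j - 3))"
      using R by (auto simp: y_def intro!: sum.neutral)
    then show "(\<Sum>c\<in>R. y c j) \<le> 1"
      using R IH(3)[of "j - 3"] IH(5) by (simp add: y_def)
  qed
  moreover have "\<forall>c j. 0 \<le> y c j" "\<forall>c j. c \<notin> R \<longrightarrow> y c j = 0"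
    using IH(4,5) R by (auto simp: y_def)
  moreover have "measure_pmf.expectation (bind_pmf P (\<lambda>h. run_alg alg n B h bs')) (potential M n {}) \<le>
     measure_pmf.expectation P (potential M n R) + 3 * (\<Sum>j=1..Suc k. gain M j)"
  proof -
    have "bind_pmf P (\<lambda>h. run_alg alg n B h bs') = bind_pmf Q (\<lambda>h. run_alg alg n B h bs)"
      unfolding bs'_def Q_def S_def by (simp only: bind_run_alg_Cons)
    then show ?thesis using IH(6) Q a(2) b(2) by (simp add: T_def)
  qed
  moreover have "set bs' \<subseteq> range bid" using IH(1) by (auto simp: bs'_def)
  ultimately show ?case by blast
qed

section \<open>Harmonic sums and the total gain\<close>

text \<open>Telescoping of \<open>ln (1 + 1 / k) \<le> 1 / k\<close>.\<close>

lemma sum_inverse_ge_ln: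
  assumes "m \<le> n"
  shows "ln (real n + 1) - ln (real m + 1) \<le> (\<Sum>k=m+1..n. 1 / real k)"
  using assms
proof (induction n rule: dec_induct)
  case (step n)
  have "ln (real (Suc n) + 1) - ln (real n + 1) = ln ((real (Suc n) + 1) / (real n + 1))"
    by (subst ln_div) auto
  also have "\<dots> = ln (1 + 1 / real (Suc n))"
    by (rule arg_cong[where f = ln]) (simp add: field_simps)
  also have "\<dots> \<le> 1 / real (Suc n)"
    by (rule ln_add_one_self_le_self) simp
  finally show ?case using step by simp
qed simp

text \<open>Telescoping gives \<open>ln (2 * m + 1) - ln (m + 1)\<close>; replacing
  \<open>2 * m + 1\<close> by \<open>2 * m + 2\<close> yields \<open>ln 2\<close> at a cost of at
  most \<open>1 / (2 * m + 1)\<close>.\<close>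

lemma sum_inverse_doubling_ge:
  "ln 2 - 1 / (2 * real m + 1) \<le> (\<Sum>k=m+1..2*m. 1 / real k)"
proof -
  have "ln (2 * real m + 2) - ln (2 * real m + 1) = ln ((2 * real m + 2) / (2 * real m + 1))"
    by (subst ln_div) auto
  also have "\<dots> = ln (1 + 1 / (2 * real m + 1))"
    by (rule arg_cong[where f = ln]) (simp add: field_simps)
  also have "\<dots> \<le> 1 / (2 * real m + 1)"
    by (rule ln_add_one_self_le_self) simp
  finally have "ln (2 * real m + 2) - 1 / (2 * real m + 1) \<le> ln (2 * real m + 1)"
    by simp
  moreover have "ln (2 * real m + 2) = ln 2 + ln (real m + 1)"
    using ln_mult[of 2 "real m + 1"] by (simp add: algebra_simps)
  ultimately show ?thesis using sum_inverse_ge_ln[of m "2 * m"] by simp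
qed

lemma ln_2_ge: "(0.693 :: real) \<le> ln 2"
  using ln_approx_bounds[of 2 3, simplified, simplified eval_nat_numeral, simplified] by simp

text \<open>The two nonzero cases of \<open>gain\<close> live on ranges that each double their lower
  end; the bound \<open>2*(2*M)\<close> is written to match \<open>sum_inverse_doubling_ge\<close>
  at \<open>2 * M\<close>.\<close>

lemma sum_gain:
  "(\<Sum>k=1..4*M. gain M k) = 5 * real M - real M * (\<Sum>k=M+1..2*M. 1 / real k) -
     3 * real M * (\<Sum>k=2*M+1..2*(2*M). 1 / real k)"
proof -
  have "(\<Sum>k=1..4*M. gain M k) = (\<Sum>k=1..M. gain M k) + 
      (\<Sum>k=M+1..2*M. gain M k) + (\<Sum>k=2*M+1..4*M. gain M k)"
    using sum.ub_add_nat[of 1 M "gain M" M] sum.ub_add_nat[of 1 "2 * M" "gain M" "2 * M"]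
    by (simp add: mult_2 [symmetric])
  also have "(\<Sum>k=1..M. gain M k) = 0"
    by (simp add: gain_def)
  also have "(\<Sum>k=M+1..2*M. gain M k) = (\<Sum>k=M+1..2*M. 1 - real M * (1 / real k))"
    by (intro sum.cong) (auto simp: gain_def)
  also have "\<dots> = real M - real M * (\<Sum>k=M+1..2*M. 1 / real k)"
    by (simp add: sum_subtractf sum_distrib_left)
  also have "(\<Sum>k=2*M+1..4*M. gain M k) = (\<Sum>k=2*M+1..4*M. 2 - 3 * real M * (1 / real k))"
    by (intro sum.cong) (auto simp: gain_def)
  also have "\<dots> = 4 * real M - 3 * real M * (\<Sum>k=2*M+1..2*(2*M). 1 / real k)"
    by (simp add: sum_subtractf sum_distrib_left)
  finally show ?thesis by simp
qed

section \<open>From the potential to revenue and LP value\<close>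

lemma revenue_eq_potential:
  assumes "\<And>x c. (x, c) \<in> set h \<Longrightarrow> x \<in> range bid"
  shows "revenue n (\<lambda>_. 3) h = potential M n {} h"
proof -
  have "(\<Sum>(x, c)\<leftarrow>h. if c = Some a then x a else 0) = 2 * real (level h a)" for a
    using assms
  proof (induction h)
    case (Cons z h)
    obtain x c where z: "z = (x, c)" by (cases z)
    obtain R where "x = bid R" using Cons.prems[of x c] z by auto
    then show ?case using Cons z by (auto simp: level_def bid_def)
  qed (simp add: level_def)
  then show ?thesis by (simp add: revenue_def potential_def pay_def)
qed

lemma run_alg_bids:
  assumes "h' \<in> set_pmf (run_alg alg n B h xs)"
  shows "map fst h' = map fst h @ xs"
  using assms by (induction xs arbitrary: h) fastforce+

lemma lp_value_ge:
  assumes "lp_feasible n B bs x"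
  shows "(\<Sum>a<n. \<Sum>k<length bs. (bs ! k) a * x a k) \<le> lp_value n B bs"
  unfolding lp_value_def
proof (rule cSup_upper)
  \<comment> \<open>Summing the budget constraints bounds every objective value by the total
    budget.\<close>
  show "bdd_above {\<Sum>a<n. \<Sum>k<length bs. (bs ! k) a * x a k |x. lp_feasible n B bs x}"
    by (rule bdd_aboveI[where M = "sum B {..<n}"]) (auto simp: lp_feasible_def intro!: sum_mono)
qed (use assms in blast)

theorem theorem3p3:
  fixes alg :: online_alg
  shows "\<exists>n B bs. valid_instance n B bs \<and> lp_value n B bs > 0 \<and>
           expected_revenue alg n B bs \<le> 0.612 * lp_value n B bs"
proof -
  define M :: nat where "M = 1000"
  define n where "n = 8 * M"
  define B :: "nat \<Rightarrow> real" where "B = (\<lambda>_. 3)"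
  obtain bs x where bs: "set bs \<subseteq> range bid"
     "\<And>a. a < n \<Longrightarrow> (\<Sum>j<length bs. (bs ! j) a * x a j) = 3"
     "\<And>j. (\<Sum>a<n. x a j) \<le> 1" "\<And>a j. 0 \<le> x a j"
     "measure_pmf.expectation (run_alg alg n B [] bs) (potential M n {}) \<le>
      potential M n {..<n} [] + 3 * (\<Sum>j=1..4*M. gain M j)"
    using adversary[of "{..<n}" n "4 * M" "return_pmf []" alg B M]
    by (auto simp: bind_return_pmf n_def)
  have "lp_feasible n B bs x"
    using bs by (simp add: lp_feasible_def B_def)
  from lp_value_ge[OF this] have lp: "24000 \<le> lp_value n B bs"
    using bs(2) by (simp add: n_def M_def)
  have "expected_revenue alg n B bs =
      measure_pmf.expectation (run_alg alg n B [] bs) (potential M n {})"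
    unfolding expected_revenue_def
  proof (rule integral_cong_AE)
    \<comment> \<open>The two functions need not agree on arbitrary histories, but every history in
      the support of the run consists of items from \<open>range bid\<close>.\<close>
    show "AE h in run_alg alg n B [] bs. revenue n B h = potential M n {} h"
      unfolding AE_measure_pmf_iff
    proof
      fix h assume "h \<in> set_pmf (run_alg alg n B [] bs)"
      from run_alg_bids[OF this] have "set (map fst h) \<subseteq> range bid" using bs(1) by simp
      then show "revenue n B h = potential M n {} h"
        unfolding B_def by (intro revenue_eq_potential) force
    qed
  qed auto
  also have "\<dots> \<le> potential M n {..<n} [] + 3 * (\<Sum>j=1..4*M. gain M j)"
    by (rule bs(5))
  also have "potential M n {..<n} [] = 8000"
    by (simp add: potential_def level_def pay_def weight_def n_def M_def)
  \<comment> \<open>With \<open>ln 2 \<ge> 0.693\<close> the main terms give at most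
    \<open>23000 - 12000 * 0.693 = 14684\<close>, and the errors of the two harmonic bounds add less
    than 3.75; the target is 14688, so \<open>M = 1000\<close> suffices.\<close>
  also have "8000 + 3 * (\<Sum>j=1..4*M. gain M j) \<le> 0.612 * 24000"
    using ln_2_ge sum_inverse_doubling_ge[of M] sum_inverse_doubling_ge[of "2 * M"]
    unfolding sum_gain by (simp add: M_def)
  also have "\<dots> \<le> 0.612 * lp_value n B bs" using lp by simp
  finally have "expected_revenue alg n B bs \<le> 0.612 * lp_value n B bs" by simp
  moreover have "valid_instance n B bs"
    using bs(1) by (auto simp: valid_instance_def B_def bid_def)
  ultimately show ?thesis using lp by (intro exI[of _ n] exI[of _ B] exI[of _ bs]) auto
qed

end
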